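(* Let $X$ be a Hilbert space and $x_0\in X$. Consider the following scenarios. (1) (SIP) Let $K_1,\dots,K_r\subset X$ be nonempty closed convex sets with $K:=\bigcap_{l=1}^rK_l=\emptyset$. Suppose the SHQP algorithm (see context) is run with $\bar p=\infty$ and the conditions $$S_i\subset S_{i+1}\ \text{ for all } i\ge0,\qquad (i,l_i^* )\in S_i\ \text{ for all } i\ge0$$ hold. If $\tilde F_i=\emptyset$ for some $i$, then infeasibility is detected. Otherwise, the sequence $\{x_i\}$ produced cannot have strong cluster points. (2) (CIP) Let $X=\mathbb{R}^n$ and let $f:\mathbb{R}^n\to\mathbb{R}$ be convex with $f^{-1}((-\infty,0])=\emptyset$. Suppose the SGQP algorithm (see context) is run with $\bar p=\infty$ and $S_i=\{0,1,\dots,i\}$ for all $i\ge0$. If $F_i=\emptyset$ for some $i$, then infeasibility is detected. Otherwise, the sequence $\{x_i\}$ produced cannot have strong cluster points. (3) (BAP) Let $K_1,\dots,K_r\subset X$ be nonempty closed convex sets with $K:=\bigcap_{l=1}^rK_l=\emptyset$. Suppose the BAP algorithm (see context) is run and $$S_i\subset S_{i+1}\ \text{ for all } i\ge0,\qquad (i,l_i^* )\in S_i\ \text{ for all } i\ge0$$ hold. If $F_i=\emptyset$ for some $i$, then infeasibility is detected. Otherwise, the sequence $\{x_i\}$ produced cannot have strong cluster points.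
   Context: A strong cluster point is a cluster point in the norm topology. "Infeasibility is detected" means that the algorithm stops, the emptiness of $\tilde F_i$ (or $F_i$) certifying that the problem is infeasible (these sets contain $K$, resp. $f^{-1}((-\infty,0])$). $P_C$ is the projection onto $C$; $\mathrm{conv}$ is the convex hull; $\mathrm{pos}(S)=\{ts\mid t\ge0,\ s\in S\}$; $\partial f$ is the convex subdifferential. Common notation for SHQP and BAP: at iteration $i$, for $l\in\{1,\dots,r\}$, $x_i^{(l)}=P_{K_l}(x_i)$, $a_i^{(l)}=x_i-x_i^{(l)}$, $b_i^{(l)}=\langle a_i^{(l)},x_i^{(l)}\rangle$; $l_i^*\in\{1,\dots,r\}$ is an index attaining $\max_{1\le l\le r}\|x_i-P_{K_l}(x_i)\|$; $H^{\le}_{(j,l)}=\{x:\langle a_j^{(l)},x\rangle\le b_j^{(l)}\}$. SHQP algorithm (with $\bar p=\infty$): starting from $x_0$, at iteration $i\ge 0$ choose $S_i\subset\{0,\dots,i\}\times\{1,\dots,r\}$, set $\tilde F_i=\bigcap_{(j,l)\in S_i}H^{\le}_{(j,l)}$, and choose $x_{i+1}$ such that (1) $x_{i+1}\in\tilde F_i$; (2) $\|x_{i+1}-c\|\le\|x_i-c\|$ for all $c\in K$; (3) $x_i-x_{i+1}\in\mathrm{pos}(\mathrm{conv}\{a_j^{(l)}:(j,l)\in S_i\})$. SGQP algorithm (with $\bar p=\infty$): starting from $x_0$, at iteration $i\ge 0$ find $y_i\in\partial f(x_i)$, set $H_i^{\le}=\{x\mid f(x_i)+\langle y_i,x-x_i\rangle\le0\}$,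 choose $S_i\subset\{0,\dots,i\}$, set $F_i=\bigcap_{k\in S_i}H_k^{\le}$, and find $x_{i+1}$ such that (1) $x_{i+1}\in F_i$; (2) $\|x_{i+1}-c\|\le\|x_i-c\|$ for all $c\in f^{-1}((-\infty,0])$; (3) $x_i-x_{i+1}\in\mathrm{pos}(\mathrm{conv}\{y_k\}_{k\in S_i})$. BAP algorithm: starting from $x_0$, at iteration $i\ge 0$ choose $S_i\subset\{0,\dots,i\}\times\{1,\dots,r\}$, set $F_i=\bigcap_{(j,l)\in S_i}H^{\le}_{(j,l)}$, and let $x_{i+1}=P_{F_i}(x_0)$. *)

theory Defs
  imports "HOL-Analysis.Analysis"
begin

(* The library's closest_point is restricted to Heine-Borel (finite-dimensional) spaces.  For a
   nonempty closed convex C in a Hilbert space the minimiser below exists and is unique. *)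
definition metric_proj :: "'a::real_inner set \<Rightarrow> 'a \<Rightarrow> 'a" where
  "metric_proj C x = (ARG_MIN (\<lambda>p. norm (x - p)) p. p \<in> C)"

definition pos :: "'a::real_vector set \<Rightarrow> 'a set" where
  "pos A = {t *\<^sub>R s | t s. 0 \<le> t \<and> s \<in> A}"

definition subdifferential :: "('a::real_inner \<Rightarrow> real) \<Rightarrow> 'a \<Rightarrow> 'a set" where
  "subdifferential f x = {y. \<forall>z. f z \<ge> f x + y \<bullet> (z - x)}"

definition strong_cluster_point :: "(nat \<Rightarrow> 'a::real_normed_vector) \<Rightarrow> 'a \<Rightarrow> bool" where
  "strong_cluster_point x p \<longleftrightarrow> (\<exists>\<phi>. strict_mono \<phi> \<and> (x \<circ> \<phi>) \<longlonglongrightarrow> p)"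

(* A run of an algorithm is described by N :: enat together with total sequences of which only
   the data of iterations i <= N are meaningful: N = \<infinity> for a run that never stops, and
   N = enat n if the run stops at iteration n.  The algorithms stop exactly when the set F i built
   at iteration i is empty. *)
definition stops_when_empty :: "(nat \<Rightarrow> 'a set) \<Rightarrow> enat \<Rightarrow> bool" where
  "stops_when_empty F N \<longleftrightarrow>
     (\<forall>i. enat i < N \<longrightarrow> F i \<noteq> {}) \<and> (\<forall>n. N = enat n \<longrightarrow> F n = {})"

definition sip_normal :: "(nat \<Rightarrow> 'a::real_inner set) \<Rightarrow> (nat \<Rightarrow> 'a) \<Rightarrow> nat \<times> nat \<Rightarrow> 'a" where
  "sip_normal K x = (\<lambda>(j, l). x j - metric_proj (K l) (x j))"

definition sip_offset :: "(nat \<Rightarrow> 'a::real_inner set) \<Rightarrow> (nat \<Rightarrow> 'a) \<Rightarrow> nat \<times> nat \<Rightarrow> real" where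
  "sip_offset K x = (\<lambda>(j, l). sip_normal K x (j, l) \<bullet> metric_proj (K l) (x j))"

definition sip_halfspace :: "(nat \<Rightarrow> 'a::real_inner set) \<Rightarrow> (nat \<Rightarrow> 'a) \<Rightarrow> nat \<times> nat \<Rightarrow> 'a set" where
  "sip_halfspace K x jl = {z. sip_normal K x jl \<bullet> z \<le> sip_offset K x jl}"

definition sip_polyhedron ::
  "(nat \<Rightarrow> 'a::real_inner set) \<Rightarrow> (nat \<Rightarrow> 'a) \<Rightarrow> (nat \<Rightarrow> (nat \<times> nat) set) \<Rightarrow> nat \<Rightarrow> 'a set" where
  "sip_polyhedron K x S i = (\<Inter>jl\<in>S i. sip_halfspace K x jl)"

definition farthest_index :: "nat \<Rightarrow> (nat \<Rightarrow> 'a::real_inner set) \<Rightarrow> 'a \<Rightarrow> nat \<Rightarrow> bool" where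
  "farthest_index r K z m \<longleftrightarrow>
     m \<in> {1..r} \<and> norm (z - metric_proj (K m) z) = (MAX l\<in>{1..r}. norm (z - metric_proj (K l) z))"

definition sip_selection ::
  "nat \<Rightarrow> (nat \<Rightarrow> 'a::real_inner set) \<Rightarrow> (nat \<Rightarrow> 'a) \<Rightarrow> (nat \<Rightarrow> (nat \<times> nat) set) \<Rightarrow> (nat \<Rightarrow> nat)
    \<Rightarrow> enat \<Rightarrow> bool" where
  "sip_selection r K x S lstar N \<longleftrightarrow>
     (\<forall>i. enat i \<le> N \<longrightarrow> farthest_index r K (x i) (lstar i) \<and> (i, lstar i) \<in> S i) \<and>
     (\<forall>i. enat (Suc i) \<le> N \<longrightarrow> S i \<subseteq> S (Suc i))"

definition shqp_run ::
  "nat \<Rightarrow> (nat \<Rightarrow> 'a::real_inner set) \<Rightarrow> 'a \<Rightarrow> (nat \<Rightarrow> 'a) \<Rightarrow> (nat \<Rightarrow> (nat \<times> nat) set) \<Rightarrow> enat \<Rightarrow> bool" where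
  "shqp_run r K x0 x S N \<longleftrightarrow>
     x 0 = x0 \<and>
     (\<forall>i. enat i \<le> N \<longrightarrow> S i \<subseteq> {0..i} \<times> {1..r}) \<and>
     stops_when_empty (sip_polyhedron K x S) N \<and>
     (\<forall>i. enat i < N \<longrightarrow>
        x (Suc i) \<in> sip_polyhedron K x S i \<and>
        (\<forall>c \<in> (\<Inter>l\<in>{1..r}. K l). norm (x (Suc i) - c) \<le> norm (x i - c)) \<and>
        x i - x (Suc i) \<in> pos (convex hull (sip_normal K x ` S i)))"

definition bap_run ::
  "nat \<Rightarrow> (nat \<Rightarrow> 'a::real_inner set) \<Rightarrow> 'a \<Rightarrow> (nat \<Rightarrow> 'a) \<Rightarrow> (nat \<Rightarrow> (nat \<times> nat) set) \<Rightarrow> enat \<Rightarrow> bool" where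
  "bap_run r K x0 x S N \<longleftrightarrow>
     x 0 = x0 \<and>
     (\<forall>i. enat i \<le> N \<longrightarrow> S i \<subseteq> {0..i} \<times> {1..r}) \<and>
     stops_when_empty (sip_polyhedron K x S) N \<and>
     (\<forall>i. enat i < N \<longrightarrow> x (Suc i) = metric_proj (sip_polyhedron K x S i) x0)"

definition cip_halfspace ::
  "('a::real_inner \<Rightarrow> real) \<Rightarrow> (nat \<Rightarrow> 'a) \<Rightarrow> (nat \<Rightarrow> 'a) \<Rightarrow> nat \<Rightarrow> 'a set" where
  "cip_halfspace f x y k = {z. f (x k) + y k \<bullet> (z - x k) \<le> 0}"

definition cip_polyhedron ::
  "('a::real_inner \<Rightarrow> real) \<Rightarrow> (nat \<Rightarrow> 'a) \<Rightarrow> (nat \<Rightarrow> 'a) \<Rightarrow> (nat \<Rightarrow> nat set) \<Rightarrow> nat \<Rightarrow> 'a set" where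
  "cip_polyhedron f x y S i = (\<Inter>k\<in>S i. cip_halfspace f x y k)"

definition sgqp_run ::
  "('a::real_inner \<Rightarrow> real) \<Rightarrow> 'a \<Rightarrow> (nat \<Rightarrow> 'a) \<Rightarrow> (nat \<Rightarrow> 'a) \<Rightarrow> (nat \<Rightarrow> nat set) \<Rightarrow> enat \<Rightarrow> bool" where
  "sgqp_run f x0 x y S N \<longleftrightarrow>
     x 0 = x0 \<and>
     (\<forall>i. enat i \<le> N \<longrightarrow> y i \<in> subdifferential f (x i) \<and> S i \<subseteq> {0..i}) \<and>
     stops_when_empty (cip_polyhedron f x y S) N \<and>
     (\<forall>i. enat i < N \<longrightarrow>
        x (Suc i) \<in> cip_polyhedron f x y S i \<and>
        (\<forall>c \<in> f -` {..0}. norm (x (Suc i) - c) \<le> norm (x i - c)) \<and>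
        x i - x (Suc i) \<in> pos (convex hull (y ` S i)))"

(* C is the solution set, F the sequence of outer approximations.  Emptiness of F i proves C = {}
   because C \<subseteq> F i; the notion is only meaningful where C = {} is not among the
   hypotheses. *)
definition emptiness_detects_infeasibility :: "'a set \<Rightarrow> (nat \<Rightarrow> 'a set) \<Rightarrow> enat \<Rightarrow> bool" where
  "emptiness_detects_infeasibility C F N \<longleftrightarrow>
     (\<forall>i. enat i \<le> N \<longrightarrow> C \<subseteq> F i \<and> (F i = {} \<longrightarrow> N = enat i \<and> C = {}))"

definition otherwise_no_strong_cluster_point ::
  "(nat \<Rightarrow> 'a::real_normed_vector set) \<Rightarrow> (nat \<Rightarrow> 'a) \<Rightarrow> enat \<Rightarrow> bool" where
  "otherwise_no_strong_cluster_point F x N \<longleftrightarrow>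
     ((\<forall>i. enat i \<le> N \<longrightarrow> F i \<noteq> {}) \<longrightarrow> N = \<infinity> \<and> \<not> (\<exists>p. strong_cluster_point x p))"

end

theory Submission
  imports Defs
begin

text \<open>
  The contradiction is that a strong cluster point of a run that never stops would be a solution of
  the infeasible problem. Two facts carry this.

  First, every later iterate satisfies every cut that an earlier iterate selected, since the set of
  active cuts grows and each iterate lies in the polyhedron that the preceding cuts define. A cut made
  at \<open>x i\<close> excludes \<open>x i\<close> with a margin comparable to the violation at \<open>x i\<close> of the constraint it
  comes from. Hence the violation at \<open>x i\<close> is at most a constant times the distance from \<open>x i\<close> to
  any later iterate. Along a convergent subsequence consecutive terms become arbitrarily close, so the
  violation tends to zero (\<open>depth_tendsto_zero_of_cluster\<close>).

  Second, vanishing violation puts the limit into the feasible set. For sets \<open>K l\<close> the violation is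
  the largest distance to one of them, so all projections of the subsequence converge to the same
  limit, and closedness puts it into each \<open>K l\<close>. For a convex function \<open>f\<close> on a Euclidean space the
  violation is the value \<open>f (x i)\<close>; the constant is a bound for subgradients on a bounded set, and
  continuity of \<open>f\<close> gives \<open>f p \<le> 0\<close> at the limit \<open>p\<close>.

  In SHQP and SGQP the next iterate lies in the current polyhedron by the rules of the iteration. In BAP
  it is defined as a projection, so this rests on the existence of projections onto closed convex sets
  in a Hilbert space. The same projections make the cuts valid for the feasible set, so that an empty
  polyhedron certifies infeasibility: the projection \<open>p\<close> of \<open>x\<close> onto \<open>C\<close> satisfies the obtuse angle
  inequality \<open>(x - p) \<bullet> (c - p) \<le> 0\<close> for \<open>c \<in> C\<close>. For a convex function, validity of the cuts is the
  subgradient inequality.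
\<close>

section \<open>Projection onto closed convex sets in a Hilbert space\<close>

text \<open>
  The near-minimisers form a nested sequence of closed sets. By the parallelogram law, applied to two
  near-minimisers and their midpoint, the diameters of these sets shrink to zero, so completeness
  yields a common point.
\<close>

lemma nearest_point_exists:
  fixes C :: "'a::{real_inner, complete_space} set"
  assumes "closed C" "convex C" "C \<noteq> {}"
  obtains p where "p \<in> C" "\<And>q. q \<in> C \<Longrightarrow> norm (x - p) \<le> norm (x - q)"
proof -
  define d where "d = infdist x C"
  define e :: "nat \<Rightarrow> real" where "e n = inverse (real (Suc n))" for n
  define T where "T n = C \<inter> cball x (d + e n)" for n
  have d0: "0 \<le> d" by (simp add: d_def infdist_nonneg)
  have e0: "0 < e n" for n by (simp add: e_def)
  have dle: "d \<le> norm (x - q)" if "q \<in> C" for q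
    using infdist_le[OF that, of x] by (simp add: d_def dist_norm)
  have close: "(norm (p - q))\<^sup>2 \<le> 4 * (d + e n)\<^sup>2 - 4 * d\<^sup>2" if "p \<in> T n" "q \<in> T n" for p q n
  proof -
    let ?m = "(1/2) *\<^sub>R p + (1/2) *\<^sub>R q"
    have "?m \<in> C"
      using that convexD[OF \<open>convex C\<close>, of p q "1/2" "1/2"] by (auto simp: T_def)
    then have "d \<le> norm (x - ?m)" by (rule dle)
    then have m: "d\<^sup>2 \<le> (norm (x - ?m))\<^sup>2" using d0 by (rule power_mono)
    have pq: "(norm (x - p))\<^sup>2 \<le> (d + e n)\<^sup>2" "(norm (x - q))\<^sup>2 \<le> (d + e n)\<^sup>2"
      using that by (auto simp: T_def dist_norm intro!: power_mono)
    have "(norm (p - q))\<^sup>2 = 2 * (norm (x - p))\<^sup>2 + 2 * (norm (x - q))\<^sup>2 - 4 * (norm (x - ?m))\<^sup>2"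
      unfolding power2_norm_eq_inner
      by (simp add: inner_diff_left inner_diff_right inner_add_left inner_add_right inner_commute
          algebra_simps)
    then show ?thesis using m pq by linarith
  qed
  obtain p where p: "\<And>n. p \<in> T n"
  proof (rule decreasing_closed_nest[of T])
    show "closed (T n)" for n using \<open>closed C\<close> by (auto simp: T_def)
    show "T n \<noteq> {}" for n
    proof -
      have "(INF q\<in>C. dist x q) < d + e n"
        using e0[of n] assms(3) by (simp add: d_def infdist_notempty)
      then obtain q where "q \<in> C" "dist x q < d + e n"
        using assms(3) by (auto simp: cINF_less_iff)
      then show ?thesis by (auto simp: T_def)
    qed
    show "T n \<subseteq> T m" if "m \<le> n" for m n
    proof -
      have "e n \<le> e m" using that by (simp add: e_def le_imp_inverse_le)
      then show ?thesis by (auto simp: T_def)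
    qed
    show "\<exists>n. \<forall>p\<in>T n. \<forall>q\<in>T n. dist p q < \<epsilon>" if "\<epsilon> > 0" for \<epsilon>
    proof -
      have "e \<longlonglongrightarrow> 0" unfolding e_def by (rule LIMSEQ_inverse_real_of_nat)
      then have "(\<lambda>n. 4 * (d + e n)\<^sup>2 - 4 * d\<^sup>2) \<longlonglongrightarrow> 4 * (d + 0)\<^sup>2 - 4 * d\<^sup>2"
        by (intro tendsto_intros)
      then have "eventually (\<lambda>n. 4 * (d + e n)\<^sup>2 - 4 * d\<^sup>2 < \<epsilon>\<^sup>2) sequentially"
        using that by (intro order_tendstoD(2)) auto
      then obtain n where n: "4 * (d + e n)\<^sup>2 - 4 * d\<^sup>2 < \<epsilon>\<^sup>2"
        by (auto simp: eventually_sequentially)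
      have "dist p q < \<epsilon>" if "p \<in> T n" "q \<in> T n" for p q
        unfolding dist_norm
        by (rule power2_less_imp_less[OF le_less_trans[OF close[OF that] n]])
          (use \<open>\<epsilon> > 0\<close> in simp)
      then show ?thesis by blast
    qed
  qed (rule that)
  have "p \<in> C" using p[of 0] by (simp add: T_def)
  have "norm (x - p) \<le> d"
  proof (rule LIMSEQ_le_const)
    have "e \<longlonglongrightarrow> 0" unfolding e_def by (rule LIMSEQ_inverse_real_of_nat)
    then show "(\<lambda>n. d + e n) \<longlonglongrightarrow> d" by (auto intro: tendsto_eq_intros)
    show "\<exists>M. \<forall>n\<ge>M. norm (x - p) \<le> d + e n" using p by (auto simp: T_def dist_norm)
  qed
  then show ?thesis by (rule that[OF \<open>p \<in> C\<close> order_trans[OF _ dle]])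
qed

lemma metric_proj:
  fixes C :: "'a::{real_inner, complete_space} set"
  assumes "closed C" "convex C" "C \<noteq> {}"
  shows metric_proj_mem: "metric_proj C x \<in> C"
    and metric_proj_le: "q \<in> C \<Longrightarrow> norm (x - metric_proj C x) \<le> norm (x - q)"
proof -
  obtain p where p: "p \<in> C" "\<And>q. q \<in> C \<Longrightarrow> norm (x - p) \<le> norm (x - q)"
    using nearest_point_exists[OF assms] by metis
  have "metric_proj C x \<in> C \<and> (\<forall>q\<in>C. norm (x - metric_proj C x) \<le> norm (x - q))"
    unfolding metric_proj_def
    by (rule arg_minI[where x = p]) (use p in \<open>auto simp: not_less\<close>)
  then show "metric_proj C x \<in> C" and "q \<in> C \<Longrightarrow> norm (x - metric_proj C x) \<le> norm (x - q)"
    by auto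
qed

lemma metric_proj_obtuse:
  fixes C :: "'a::{real_inner, complete_space} set"
  assumes "closed C" "convex C" "c \<in> C"
  shows "(x - metric_proj C x) \<bullet> (c - metric_proj C x) \<le> 0"
proof (rule any_closest_point_dot)
  show "metric_proj C x \<in> C"
    using assms by (intro metric_proj_mem) auto
  show "\<forall>z\<in>C. dist x (metric_proj C x) \<le> dist x z"
    using metric_proj_le[of C] assms by (auto simp: dist_norm)
qed (use assms in auto)

section \<open>Cuts satisfied by all later iterates\<close>

text \<open>
  In the applications \<open>d m\<close> is the violation at \<open>x (\<phi> m)\<close> of the constraint being cut. Taking
  \<open>k = \<phi> (Suc m)\<close> bounds it by the distance between consecutive terms of a convergent sequence.
\<close>

lemma depth_tendsto_zero_of_cluster:
  fixes x :: "nat \<Rightarrow> 'a::real_normed_vector" and d :: "nat \<Rightarrow> real"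
  assumes "strict_mono \<phi>" and lim: "(x \<circ> \<phi>) \<longlonglongrightarrow> p"
    and nonneg: "\<And>m. 0 \<le> d m"
    and le: "\<And>m k. \<phi> m < k \<Longrightarrow> d m \<le> L * norm (x (\<phi> m) - x k)"
  shows "d \<longlonglongrightarrow> 0"
proof (rule tendsto_sandwich[where f = "\<lambda>_. 0"])
  have "(\<lambda>m. x (\<phi> m)) \<longlonglongrightarrow> p" using lim by (simp add: o_def)
  moreover from this have "(\<lambda>m. x (\<phi> (Suc m))) \<longlonglongrightarrow> p" by (rule LIMSEQ_Suc)
  ultimately have "(\<lambda>m. L * norm (x (\<phi> m) - x (\<phi> (Suc m)))) \<longlonglongrightarrow> L * norm (p - p)"
    by (intro tendsto_intros)
  then show "(\<lambda>m. L * norm (x (\<phi> m) - x (\<phi> (Suc m)))) \<longlonglongrightarrow> 0" by simp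
  show "\<forall>\<^sub>F m in sequentially. d m \<le> L * norm (x (\<phi> m) - x (\<phi> (Suc m)))"
    using le strict_monoD[OF \<open>strict_mono \<phi>\<close>] by (simp add: always_eventually)
qed (use nonneg in auto)

lemma emptiness_detects_infeasibilityI:
  assumes "stops_when_empty F N" and "\<And>i. enat i \<le> N \<Longrightarrow> C \<subseteq> F i"
  shows "emptiness_detects_infeasibility C F N"
  using assms unfolding emptiness_detects_infeasibility_def stops_when_empty_def
  by (metis order_le_less subset_empty)

lemma otherwise_no_strong_cluster_pointI:
  assumes "stops_when_empty F N"
    and "\<And>p. N = \<infinity> \<Longrightarrow> strong_cluster_point x p \<Longrightarrow> False"
  shows "otherwise_no_strong_cluster_point F x N"
  unfolding otherwise_no_strong_cluster_point_def
proof
  assume ne: "\<forall>i. enat i \<le> N \<longrightarrow> F i \<noteq> {}"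
  have "N = \<infinity>"
  proof (cases N)
    case (enat n)
    then show ?thesis using assms(1) ne by (auto simp: stops_when_empty_def)
  qed simp
  then show "N = \<infinity> \<and> \<not> (\<exists>p. strong_cluster_point x p)" using assms(2) by blast
qed

section \<open>Intersections of convex sets\<close>

lemma closed_sip_polyhedron: "closed (sip_polyhedron K x S i)"
  and convex_sip_polyhedron: "convex (sip_polyhedron K x S i)"
  unfolding sip_polyhedron_def sip_halfspace_def
  by (auto intro!: closed_INT convex_INT closed_halfspace_le convex_halfspace_le)

lemma intersection_subset_sip_polyhedron:
  fixes K :: "nat \<Rightarrow> 'a::{real_inner, complete_space} set"
  assumes "\<And>l. l \<in> {1..r} \<Longrightarrow> closed (K l) \<and> convex (K l)"
    and "S i \<subseteq> {0..i} \<times> {1..r}"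
  shows "(\<Inter>l\<in>{1..r}. K l) \<subseteq> sip_polyhedron K x S i"
proof
  fix c assume c: "c \<in> (\<Inter>l\<in>{1..r}. K l)"
  have "c \<in> sip_halfspace K x (j, l)" if "(j, l) \<in> S i" for j l
  proof -
    have l: "l \<in> {1..r}" using that assms(2) by auto
    have "(x j - metric_proj (K l) (x j)) \<bullet> (c - metric_proj (K l) (x j)) \<le> 0"
      using c l assms(1)[OF l] by (intro metric_proj_obtuse) auto
    then show ?thesis
      by (simp add: sip_halfspace_def sip_offset_def sip_normal_def inner_diff_right)
  qed
  then show "c \<in> sip_polyhedron K x S i" by (auto simp: sip_polyhedron_def)
qed

text \<open>
  For a point in the cut the normal \<open>a\<close> at \<open>x j\<close> satisfies \<open>\<parallel>a\<parallel>\<^sup>2 \<le> a \<bullet> (x j - z)\<close>, because the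
  bounding hyperplane passes through \<open>x j - a\<close>.
\<close>

lemma norm_sip_normal_le_dist_halfspace:
  assumes "z \<in> sip_halfspace K x (j, l)"
  shows "norm (sip_normal K x (j, l)) \<le> norm (x j - z)"
proof -
  let ?a = "sip_normal K x (j, l)"
  have "?a \<bullet> z \<le> ?a \<bullet> (x j - ?a)"
    using assms by (simp add: sip_halfspace_def sip_offset_def sip_normal_def)
  then have "norm ?a * norm ?a \<le> ?a \<bullet> (x j - z)"
    by (simp add: inner_diff_right power2_norm_eq_inner[symmetric] power2_eq_square)
  also have "\<dots> \<le> norm ?a * norm (x j - z)" by (rule norm_cauchy_schwarz)
  finally show ?thesis
    by (cases "norm ?a = 0") auto
qed

lemma sip_cluster_point_feasible:
  fixes K :: "nat \<Rightarrow> 'a::{real_inner, complete_space} set"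
  assumes K: "\<And>l. l \<in> {1..r} \<Longrightarrow> K l \<noteq> {} \<and> closed (K l) \<and> convex (K l)"
    and sel: "sip_selection r K x S lstar \<infinity>"
    and step: "\<And>i. x (Suc i) \<in> sip_polyhedron K x S i"
    and "strong_cluster_point x p"
  shows "p \<in> (\<Inter>l\<in>{1..r}. K l)"
proof
  fix l assume l: "l \<in> {1..r}"
  obtain \<phi> where \<phi>: "strict_mono \<phi>" "(x \<circ> \<phi>) \<longlonglongrightarrow> p"
    using assms(4) by (auto simp: strong_cluster_point_def)
  have far: "farthest_index r K (x i) (lstar i)" and inS: "(i, lstar i) \<in> S i"
    and "S i \<subseteq> S (Suc i)" for i
    using sel by (auto simp: sip_selection_def)
  then have S_mono: "S i \<subseteq> S k" if "i \<le> k" for i k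
    using that by (simp add: lift_Suc_mono_le)
  have dist_le: "norm (x i - metric_proj (K l) (x i)) \<le> norm (sip_normal K x (i, lstar i))" for i
    using far[of i] l by (auto simp: farthest_index_def sip_normal_def)
  have depth: "norm (x i - metric_proj (K l) (x i)) \<le> 1 * norm (x i - x k)" if "i < k" for i k
  proof -
    obtain k' where k: "k = Suc k'" "i \<le> k'" using \<open>i < k\<close> by (metis less_Suc_eq_le not0_implies_Suc not_less0)
    have "x k \<in> sip_halfspace K x (i, lstar i)"
      using step[of k'] S_mono[OF k(2)] inS[of i] k(1) by (auto simp: sip_polyhedron_def)
    then have "norm (sip_normal K x (i, lstar i)) \<le> norm (x i - x k)"
      by (rule norm_sip_normal_le_dist_halfspace)
    then show ?thesis using dist_le[of i] by linarith
  qed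
  have "(\<lambda>m. norm (x (\<phi> m) - metric_proj (K l) (x (\<phi> m)))) \<longlonglongrightarrow> 0"
    by (rule depth_tendsto_zero_of_cluster[OF \<phi> _ depth]) simp_all
  then have "(\<lambda>m. x (\<phi> m) - metric_proj (K l) (x (\<phi> m))) \<longlonglongrightarrow> 0"
    by (rule tendsto_norm_zero_cancel)
  with \<phi>(2) have "(\<lambda>m. x (\<phi> m) - (x (\<phi> m) - metric_proj (K l) (x (\<phi> m)))) \<longlonglongrightarrow> p - 0"
    unfolding o_def by (rule tendsto_diff)
  then have lim: "(\<lambda>m. metric_proj (K l) (x (\<phi> m))) \<longlonglongrightarrow> p" by simp
  have "metric_proj (K l) (x (\<phi> m)) \<in> K l" for m
    using K[OF l] by (simp add: metric_proj_mem)
  then show "p \<in> K l"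
    using K[OF l] by (intro closed_sequentially[OF _ _ lim]) auto
qed

text \<open>The part of the argument that SHQP and BAP share.\<close>

lemma sip_infeasibility:
  fixes K :: "nat \<Rightarrow> 'a::{real_inner, complete_space} set"
  assumes K: "\<forall>l\<in>{1..r}. K l \<noteq> {} \<and> closed (K l) \<and> convex (K l)"
    and S: "\<forall>i. enat i \<le> N \<longrightarrow> S i \<subseteq> {0..i} \<times> {1..r}"
    and stops: "stops_when_empty (sip_polyhedron K x S) N"
    and sel: "sip_selection r K x S lstar N"
    and step: "\<And>i. enat i < N \<Longrightarrow> x (Suc i) \<in> sip_polyhedron K x S i"
  shows "emptiness_detects_infeasibility (\<Inter>l\<in>{1..r}. K l) (sip_polyhedron K x S) N \<and>
    ((\<Inter>l\<in>{1..r}. K l) = {} \<longrightarrow>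
       otherwise_no_strong_cluster_point (sip_polyhedron K x S) x N)"
proof (intro conjI impI)
  show "emptiness_detects_infeasibility (\<Inter>l\<in>{1..r}. K l) (sip_polyhedron K x S) N"
  proof (rule emptiness_detects_infeasibilityI[OF stops])
    show "(\<Inter>l\<in>{1..r}. K l) \<subseteq> sip_polyhedron K x S i" if "enat i \<le> N" for i
      using K S that by (intro intersection_subset_sip_polyhedron) blast+
  qed
  assume empty: "(\<Inter>l\<in>{1..r}. K l) = {}"
  show "otherwise_no_strong_cluster_point (sip_polyhedron K x S) x N"
  proof (rule otherwise_no_strong_cluster_pointI[OF stops])
    fix p assume "N = \<infinity>" "strong_cluster_point x p"
    then have "p \<in> (\<Inter>l\<in>{1..r}. K l)"
      using K sel step by (intro sip_cluster_point_feasible[where S = S and lstar = lstar]) auto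
    then show False unfolding empty by simp
  qed
qed

section \<open>Sublevel sets of convex functions\<close>

text \<open>
  A subgradient \<open>y\<close> at \<open>z\<close> makes \<open>f\<close> grow by at least \<open>\<parallel>y\<parallel>\<close> along the unit step from \<open>z\<close> in the
  direction of \<open>y\<close>. That step stays in a slightly larger ball, on which the continuous function \<open>f\<close>
  is bounded.
\<close>

lemma subgradients_bounded:
  fixes f :: "'a::euclidean_space \<Rightarrow> real"
  assumes "continuous_on UNIV f" "bounded Z"
  obtains M where "0 \<le> M" "\<And>z y. z \<in> Z \<Longrightarrow> y \<in> subdifferential f z \<Longrightarrow> norm y \<le> M"
proof -
  obtain R where R: "\<And>z. z \<in> Z \<Longrightarrow> norm z \<le> R"
    using \<open>bounded Z\<close> by (auto simp: bounded_iff)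
  have "bounded (f ` cball 0 (R + 1))"
    using assms(1)
    by (intro compact_imp_bounded compact_continuous_image) (auto intro: continuous_on_subset)
  then obtain B where "\<forall>v\<in>f ` cball 0 (R + 1). norm v \<le> B"
    unfolding bounded_iff by blast
  then have B: "\<bar>f z\<bar> \<le> B" if "norm z \<le> R + 1" for z
    using that by simp
  have "norm y \<le> 2 * \<bar>B\<bar>" if "z \<in> Z" "y \<in> subdifferential f z" for z y
  proof (cases "y = 0")
    case False
    have "f z + y \<bullet> sgn y \<le> f (z + sgn y)"
      using that(2) by (auto simp: subdifferential_def dest: spec[of _ "z + sgn y"])
    moreover have "y \<bullet> sgn y = norm y"
      using False by (simp add: sgn_div_norm power2_norm_eq_inner[symmetric] power2_eq_square)
    moreover have "norm (z + sgn y) \<le> R + 1"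
      using norm_triangle_ineq[of z "sgn y"] R[OF that(1)] False by (simp add: norm_sgn)
    then have "\<bar>f (z + sgn y)\<bar> \<le> B" by (rule B)
    moreover have "\<bar>f z\<bar> \<le> B" using R[OF that(1)] by (intro B) simp
    ultimately show ?thesis by linarith
  qed simp
  then show ?thesis by (intro that[of "2 * \<bar>B\<bar>"]) auto
qed

lemma sublevel_subset_cip_polyhedron:
  assumes "\<And>k. k \<in> S i \<Longrightarrow> y k \<in> subdifferential f (x k)"
  shows "f -` {..0} \<subseteq> cip_polyhedron f x y S i"
  using assms unfolding cip_polyhedron_def cip_halfspace_def subdifferential_def
  by (auto intro: order_trans)

text \<open>
  The cut at \<open>x i\<close> gives \<open>f (x i) \<le> y i \<bullet> (x i - x k)\<close> for every later \<open>x k\<close>. Along a convergent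
  subsequence the subgradients \<open>y i\<close> are bounded, so the values of \<open>f\<close> tend to zero. The sign
  condition on \<open>f\<close> is what infeasibility supplies.
\<close>

lemma cip_cluster_point_feasible:
  fixes f :: "'a::euclidean_space \<Rightarrow> real"
  assumes "convex_on UNIV f"
    and pos: "\<And>i. 0 \<le> f (x i)"
    and sub: "\<And>i. y i \<in> subdifferential f (x i)"
    and cut: "\<And>i k. i < k \<Longrightarrow> x k \<in> cip_halfspace f x y i"
    and "strong_cluster_point x p"
  shows "f p \<le> 0"
proof -
  obtain \<phi> where \<phi>: "strict_mono \<phi>" "(x \<circ> \<phi>) \<longlonglongrightarrow> p"
    using assms(5) by (auto simp: strong_cluster_point_def)
  have cont: "continuous_on UNIV f"
    using \<open>convex_on UNIV f\<close> by (intro convex_on_continuous) auto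
  have "bounded (range (x \<circ> \<phi>))" using \<phi>(2) by (rule convergent_imp_bounded)
  then obtain M where M: "0 \<le> M"
      "\<And>z y. z \<in> range (x \<circ> \<phi>) \<Longrightarrow> y \<in> subdifferential f z \<Longrightarrow> norm y \<le> M"
    using subgradients_bounded[OF cont] by metis
  have depth: "f (x (\<phi> m)) \<le> M * norm (x (\<phi> m) - x k)" if "\<phi> m < k" for m k
  proof -
    have "f (x (\<phi> m)) \<le> y (\<phi> m) \<bullet> (x (\<phi> m) - x k)"
      using cut[OF that] by (simp add: cip_halfspace_def inner_diff_right)
    also have "\<dots> \<le> norm (y (\<phi> m)) * norm (x (\<phi> m) - x k)" by (rule norm_cauchy_schwarz)
    also have "\<dots> \<le> M * norm (x (\<phi> m) - x k)"
      using M(2)[OF _ sub] by (intro mult_right_mono) auto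
    finally show ?thesis .
  qed
  have "(\<lambda>m. f (x (\<phi> m))) \<longlonglongrightarrow> 0"
    by (rule depth_tendsto_zero_of_cluster[OF \<phi>]) (use depth pos in auto)
  moreover have "(\<lambda>m. f (x (\<phi> m))) \<longlonglongrightarrow> f p"
    using continuous_on_tendsto_compose[OF cont \<phi>(2)] by simp
  ultimately show ?thesis using LIMSEQ_unique by fastforce
qed

lemma sgqp_infeasibility:
  fixes f :: "'a::euclidean_space \<Rightarrow> real"
  assumes f: "convex_on UNIV f"
    and run: "sgqp_run f w0 x y S N"
    and S: "\<forall>i. enat i \<le> N \<longrightarrow> S i = {0..i}"
  shows "emptiness_detects_infeasibility (f -` {..0}) (cip_polyhedron f x y S) N \<and>
    (f -` {..0} = {} \<longrightarrow>
       otherwise_no_strong_cluster_point (cip_polyhedron f x y S) x N)"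
proof (intro conjI impI)
  have stops: "stops_when_empty (cip_polyhedron f x y S) N"
    and sub: "\<And>i. enat i \<le> N \<Longrightarrow> y i \<in> subdifferential f (x i)"
    and step: "\<And>i. enat i < N \<Longrightarrow> x (Suc i) \<in> cip_polyhedron f x y S i"
    using run by (auto simp: sgqp_run_def)
  show "emptiness_detects_infeasibility (f -` {..0}) (cip_polyhedron f x y S) N"
  proof (rule emptiness_detects_infeasibilityI[OF stops])
    fix i assume i: "enat i \<le> N"
    have "y k \<in> subdifferential f (x k)" if "k \<in> S i" for k
    proof (rule sub)
      have "enat k \<le> enat i" using S i that by auto
      then show "enat k \<le> N" using i by (rule order_trans)
    qed
    then show "f -` {..0} \<subseteq> cip_polyhedron f x y S i"
      by (rule sublevel_subset_cip_polyhedron)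
  qed
  assume empty: "f -` {..0} = {}"
  show "otherwise_no_strong_cluster_point (cip_polyhedron f x y S) x N"
  proof (rule otherwise_no_strong_cluster_pointI[OF stops])
    fix p assume N: "N = \<infinity>" and p: "strong_cluster_point x p"
    have pos: "\<not> f z \<le> 0" for z using empty by auto
    have "x k \<in> cip_halfspace f x y i" if "i < k" for i k
      using that step[of "k - 1"] S N by (cases k) (auto simp: cip_polyhedron_def)
    then have "f p \<le> 0"
      using sub N pos by (intro cip_cluster_point_feasible[OF f _ _ _ p]) (auto simp: less_imp_le not_le)
    then show False using pos by blast
  qed
qed

section \<open>Emptiness of the feasible set excludes strong cluster points\<close>

theorem theorem5p2:
  fixes x0 :: "'a::{real_inner, complete_space}" and w0 :: "real ^ 'n"
  shows
    "(\<forall>(r::nat) (K :: nat \<Rightarrow> 'a set) x S lstar (N::enat).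
        1 \<le> r \<and> (\<forall>l\<in>{1..r}. K l \<noteq> {} \<and> closed (K l) \<and> convex (K l)) \<and>
        shqp_run r K x0 x S N \<and> sip_selection r K x S lstar N \<longrightarrow>
          emptiness_detects_infeasibility (\<Inter>l\<in>{1..r}. K l) (sip_polyhedron K x S) N \<and>
          ((\<Inter>l\<in>{1..r}. K l) = {} \<longrightarrow>
             otherwise_no_strong_cluster_point (sip_polyhedron K x S) x N))
     \<and>
     (\<forall>(f :: real ^ 'n \<Rightarrow> real) x y S (N::enat).
        convex_on UNIV f \<and>
        sgqp_run f w0 x y S N \<and> (\<forall>i. enat i \<le> N \<longrightarrow> S i = {0..i}) \<longrightarrow>
          emptiness_detects_infeasibility (f -` {..0}) (cip_polyhedron f x y S) N \<and>
          (f -` {..0} = {} \<longrightarrow>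
             otherwise_no_strong_cluster_point (cip_polyhedron f x y S) x N))
     \<and>
     (\<forall>(r::nat) (K :: nat \<Rightarrow> 'a set) x S lstar (N::enat).
        1 \<le> r \<and> (\<forall>l\<in>{1..r}. K l \<noteq> {} \<and> closed (K l) \<and> convex (K l)) \<and>
        bap_run r K x0 x S N \<and> sip_selection r K x S lstar N \<longrightarrow>
          emptiness_detects_infeasibility (\<Inter>l\<in>{1..r}. K l) (sip_polyhedron K x S) N \<and>
          ((\<Inter>l\<in>{1..r}. K l) = {} \<longrightarrow>
             otherwise_no_strong_cluster_point (sip_polyhedron K x S) x N))"
proof (rule conjI[OF _ conjI]; (intro allI impI; elim conjE)?)
  fix r K x S lstar N
  assume K: "\<forall>l\<in>{1..r}. K l \<noteq> {} \<and> closed (K l) \<and> convex (K l :: 'a set)"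
    and run: "shqp_run r K x0 x S N" and sel: "sip_selection r K x S lstar N"
  show "emptiness_detects_infeasibility (\<Inter>l\<in>{1..r}. K l) (sip_polyhedron K x S) N \<and>
    ((\<Inter>l\<in>{1..r}. K l) = {} \<longrightarrow>
       otherwise_no_strong_cluster_point (sip_polyhedron K x S) x N)"
    using run by (intro sip_infeasibility[OF K _ _ sel]) (auto simp: shqp_run_def)
next
  fix f :: "real ^ 'n \<Rightarrow> real" and x y S N
  assume "convex_on UNIV f" "sgqp_run f w0 x y S N" "\<forall>i. enat i \<le> N \<longrightarrow> S i = {0..i}"
  then show "emptiness_detects_infeasibility (f -` {..0}) (cip_polyhedron f x y S) N \<and>
    (f -` {..0} = {} \<longrightarrow>
       otherwise_no_strong_cluster_point (cip_polyhedron f x y S) x N)"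
    by (rule sgqp_infeasibility)
next
  fix r K x S lstar N
  assume K: "\<forall>l\<in>{1..r}. K l \<noteq> {} \<and> closed (K l) \<and> convex (K l :: 'a set)"
    and run: "bap_run r K x0 x S N" and sel: "sip_selection r K x S lstar N"
  have stops: "stops_when_empty (sip_polyhedron K x S) N"
    using run by (simp add: bap_run_def)
  have "x (Suc i) \<in> sip_polyhedron K x S i" if "enat i < N" for i
  proof -
    have "sip_polyhedron K x S i \<noteq> {}"
      using stops that by (simp add: stops_when_empty_def)
    then have "metric_proj (sip_polyhedron K x S i) x0 \<in> sip_polyhedron K x S i"
      by (intro metric_proj_mem closed_sip_polyhedron convex_sip_polyhedron)
    then show ?thesis using run that by (simp add: bap_run_def)
  qed
  then show "emptiness_detects_infeasibility (\<Inter>l\<in>{1..r}. K l) (sip_polyhedron K x S) N \<and>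
    ((\<Inter>l\<in>{1..r}. K l) = {} \<longrightarrow>
       otherwise_no_strong_cluster_point (sip_polyhedron K x S) x N)"
    using run by (intro sip_infeasibility[OF K _ stops sel]) (auto simp: bap_run_def)
qed

end
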